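(* Under the mutually inverse transformations $\Phi:\ x\odot y:=(x\to y^* )^*$ and $\Psi:\ x\to y:=(x\odot y^* )^*$ between involutive BE algebras $(X,\to,^*,1)$ and involutive m-BE algebras $(X,\odot,^*,1)$, the following pairs of classes of algebras are term-equivalent: (1) pre-Wajsberg algebras and pre-MV algebras; (2) implicative-orthomodular algebras and orthomodular algebras; (3) meta-Wajsberg algebras and meta-MV algebras.
   Context: A BE algebra is an algebra $(X,\to,1)$ of type $(2,0)$ such that for all $x,y,z\in X$: $x\to x=1$; $x\to 1=1$; $1\to x=x$; $x\to (y\to z)=y\to (x\to z)$. Write $x\le y$ iff $x\to y=1$. It is bounded if there is $0\in X$ with $0\le x$ for all $x\in X$; then $x^*:=x\to 0$. It is involutive if it is bounded and $x^{**}=x$ for all $x\in X$; an involutive BE algebra is denoted $(X,\to,^*,1)$. In an involutive BE algebra define $x\Cup y=(x\to y)\to y$ and $x\Cap y=((x^*\to y^* )\to y^* )^*$. An involutive BE algebra is called: pre-Wajsberg if $x\to (x\Cap y)=x\to y$ for all $x,y$; implicative-orthomodular if $x\to (y\Cap (z\Cap x))=(x\to y)\Cap (x\to z)$ for all $x,y,z$; meta-Wajsberg if $(x\Cap y)\to (y\Cap x)=1$ for all $x,y$. An m-BE algebra is an algebra $(X,\odot,^*,1)$ of type $(2,1,0)$ such that, with $0:=1^*$, for all $x,y,z\in X$: $1\odot x=x=x\odot 1$; $x\odot y=y\odot x$; $x\odot (y\odot z)=(x\odot y)\odot z$; $x\odot 0=0$; $x\odot x^*=0$. It is involutive if $x^{**}=x$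 for all $x$. In an involutive m-BE algebra put $x\oplus y=(x^*\odot y^* )^*$, $x\Cup y=(x\odot y^* )\oplus y$ and $x\Cap y=(x\oplus y^* )\odot y$ (these agree with the operations $\Cup,\Cap$ of the corresponding involutive BE algebra). An involutive m-BE algebra is called: an orthomodular algebra if $x\Cup (x\odot y)=x$ for all $x,y$; a pre-MV algebra if $x\odot (x^*\Cup y)=x\odot y$ for all $x,y$; a meta-MV algebra if $(x\Cap y)\odot (y\Cap x)^*=0$ for all $x,y$. It is known that $\Phi$ and $\Psi$ are mutually inverse and give a term-equivalence between involutive BE algebras and involutive m-BE algebras. Term-equivalence of two subclasses means that $\Phi$ and $\Psi$ restrict to mutually inverse transformations between them. *)

theory Defs
  imports Main
begin

text \<open>Algebras are total operations on a type; the universe \<open>X\<close> is that type.\<close>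

locale BE_algebra =
  fixes imp :: "'a \<Rightarrow> 'a \<Rightarrow> 'a"  (infixr "\<rightarrow>" 65)
    and one :: 'a  ("\<one>")
  assumes imp_refl: "x \<rightarrow> x = \<one>"
    and imp_one: "x \<rightarrow> \<one> = \<one>"
    and one_imp: "\<one> \<rightarrow> x = x"
    and imp_exchange: "x \<rightarrow> (y \<rightarrow> z) = y \<rightarrow> (x \<rightarrow> z)"
begin

definition le :: "'a \<Rightarrow> 'a \<Rightarrow> bool"  (infix "\<preceq>" 50)
  where "x \<preceq> y \<longleftrightarrow> x \<rightarrow> y = \<one>"

end

text \<open>The relation \<open>\<preceq>\<close> need not be antisymmetric, so a BE algebra may have several bottom
  elements. The operation \<open>\<^sup>\<star>\<close> belongs to the signature and records which one is used:
  the axioms force it to be \<open>\<one>\<^sup>\<star>\<close>.\<close>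

locale involutive_BE_algebra = BE_algebra imp one
  for imp :: "'a \<Rightarrow> 'a \<Rightarrow> 'a"  (infixr "\<rightarrow>" 65)
    and star :: "'a \<Rightarrow> 'a"  ("_\<^sup>\<star>" [1000] 1000)
    and one :: 'a  ("\<one>") +
  assumes bounded: "\<exists>zero. (\<forall>x. zero \<preceq> x) \<and> (\<forall>x. x\<^sup>\<star> = x \<rightarrow> zero)"
    and star_star: "x\<^sup>\<star>\<^sup>\<star> = x"
begin

definition cup :: "'a \<Rightarrow> 'a \<Rightarrow> 'a"  (infixl "\<squnion>" 70)
  where "x \<squnion> y = (x \<rightarrow> y) \<rightarrow> y"

definition cap :: "'a \<Rightarrow> 'a \<Rightarrow> 'a"  (infixl "\<sqinter>" 70)
  where "x \<sqinter> y = ((x\<^sup>\<star> \<rightarrow> y\<^sup>\<star>) \<rightarrow> y\<^sup>\<star>)\<^sup>\<star>"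

end

locale pre_Wajsberg_algebra = involutive_BE_algebra +
  assumes pre_Wajsberg: "x \<rightarrow> (x \<sqinter> y) = x \<rightarrow> y"

locale implicative_orthomodular_algebra = involutive_BE_algebra +
  assumes implicative_orthomodular: "x \<rightarrow> (y \<sqinter> (z \<sqinter> x)) = (x \<rightarrow> y) \<sqinter> (x \<rightarrow> z)"

locale meta_Wajsberg_algebra = involutive_BE_algebra +
  assumes meta_Wajsberg: "(x \<sqinter> y) \<rightarrow> (y \<sqinter> x) = \<one>"

text \<open>The zero of an m-BE algebra is by definition \<open>\<one>\<^sup>\<star>\<close>.\<close>

locale m_BE_algebra =
  fixes dot :: "'a \<Rightarrow> 'a \<Rightarrow> 'a"  (infixl "\<odot>" 75)
    and star :: "'a \<Rightarrow> 'a"  ("_\<^sup>\<star>" [1000] 1000)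
    and one :: 'a  ("\<one>")
  assumes one_dot: "\<one> \<odot> x = x"
    and dot_one: "x \<odot> \<one> = x"
    and dot_commute: "x \<odot> y = y \<odot> x"
    and dot_assoc: "x \<odot> (y \<odot> z) = (x \<odot> y) \<odot> z"
    and dot_zero: "x \<odot> \<one>\<^sup>\<star> = \<one>\<^sup>\<star>"
    and dot_star: "x \<odot> x\<^sup>\<star> = \<one>\<^sup>\<star>"

locale involutive_m_BE_algebra = m_BE_algebra +
  assumes star_star: "x\<^sup>\<star>\<^sup>\<star> = x"
begin

definition oplus :: "'a \<Rightarrow> 'a \<Rightarrow> 'a"  (infixl "\<oplus>" 72)
  where "x \<oplus> y = (x\<^sup>\<star> \<odot> y\<^sup>\<star>)\<^sup>\<star>"

definition cup :: "'a \<Rightarrow> 'a \<Rightarrow> 'a"  (infixl "\<squnion>" 70)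
  where "x \<squnion> y = (x \<odot> y\<^sup>\<star>) \<oplus> y"

definition cap :: "'a \<Rightarrow> 'a \<Rightarrow> 'a"  (infixl "\<sqinter>" 70)
  where "x \<sqinter> y = (x \<oplus> y\<^sup>\<star>) \<odot> y"

end

locale orthomodular_algebra = involutive_m_BE_algebra +
  assumes orthomodular: "x \<squnion> (x \<odot> y) = x"

locale pre_MV_algebra = involutive_m_BE_algebra +
  assumes pre_MV: "x \<odot> (x\<^sup>\<star> \<squnion> y) = x \<odot> y"

locale meta_MV_algebra = involutive_m_BE_algebra +
  assumes meta_MV: "(x \<sqinter> y) \<odot> (y \<sqinter> x)\<^sup>\<star> = \<one>\<^sup>\<star>"

text \<open>The transformations \<open>\<Phi>\<close> and \<open>\<Psi>\<close> act on the binary operation only; both keep the universe,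
  \<open>\<^sup>\<star>\<close> and \<open>\<one>\<close>.\<close>

definition Phi :: "('a \<Rightarrow> 'a \<Rightarrow> 'a) \<Rightarrow> ('a \<Rightarrow> 'a) \<Rightarrow> 'a \<Rightarrow> 'a \<Rightarrow> 'a"
  where "Phi imp star = (\<lambda>x y. star (imp x (star y)))"

definition Psi :: "('a \<Rightarrow> 'a \<Rightarrow> 'a) \<Rightarrow> ('a \<Rightarrow> 'a) \<Rightarrow> 'a \<Rightarrow> 'a \<Rightarrow> 'a"
  where "Psi dot star = (\<lambda>x y. star (dot x (star y)))"

type_synonym 'a algebra_class = "('a \<Rightarrow> 'a \<Rightarrow> 'a) \<Rightarrow> ('a \<Rightarrow> 'a) \<Rightarrow> 'a \<Rightarrow> bool"

definition term_equivalent :: "'a algebra_class \<Rightarrow> 'a algebra_class \<Rightarrow> bool"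
  where "term_equivalent C D \<longleftrightarrow>
    (\<forall>imp star one. C imp star one \<longrightarrow>
       D (Phi imp star) star one \<and> Psi (Phi imp star) star = imp) \<and>
    (\<forall>dot star one. D dot star one \<longrightarrow>
       C (Psi dot star) star one \<and> Phi (Psi dot star) star = dot)"

end

theory Submission
  imports Defs
begin

text \<open>The transformations preserve the operation \<open>\<^sup>\<star>\<close> as well as both \<open>\<squnion>\<close> and \<open>\<sqinter>\<close>, so all three parts
  can be checked inside an involutive m-BE algebra with \<open>x \<rightarrow> y = (x \<odot> y\<^sup>\<star>)\<^sup>\<star>\<close>. For (1) and (3) the two
  axioms are then the same up to replacing variables by their stars. For (2), putting \<open>y = 0\<close> in the
  implicative axiom gives the dual of the orthomodular law. Conversely, with \<open>b = x \<odot> y\<close> and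
  \<open>c = x \<odot> z\<close> the starred implicative axiom reads \<open>(b \<squnion> c) \<sqinter> x = b \<squnion> c\<close>. Splitting \<open>x\<close> by the
  orthomodular law as \<open>d \<oplus> c\<close> and then \<open>d = x \<odot> c\<^sup>\<star>\<close> along \<open>d \<odot> y\<close> exhibits \<open>x\<close> as
  \<open>s \<oplus> (b \<squnion> c)\<close>, and the dual orthomodular law applies.\<close>

lemma Psi_apply: "Psi dot star x y = star (dot x (star y))"
  by (simp add: Psi_def)

context involutive_BE_algebra
begin

lemma one_star_imp: "\<one>\<^sup>\<star> \<rightarrow> x = \<one>"
  and imp_one_star: "x \<rightarrow> \<one>\<^sup>\<star> = x\<^sup>\<star>"
proof -
  obtain zero where zero: "\<And>x. zero \<rightarrow> x = \<one>" "\<And>x. x\<^sup>\<star> = x \<rightarrow> zero"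
    using bounded by (auto simp: le_def)
  moreover from zero(2)[of \<one>] have "\<one>\<^sup>\<star> = zero" by (simp add: one_imp)
  ultimately show "\<one>\<^sup>\<star> \<rightarrow> x = \<one>" "x \<rightarrow> \<one>\<^sup>\<star> = x\<^sup>\<star>" by simp_all
qed

text \<open>As a star is an implication into \<open>\<one>\<^sup>\<star>\<close>, this is the
  exchange law for \<open>x \<rightarrow> (y \<rightarrow> \<one>\<^sup>\<star>)\<close>.\<close>

lemma imp_star_commute: "x \<rightarrow> y\<^sup>\<star> = y \<rightarrow> x\<^sup>\<star>"
  by (metis imp_one_star imp_exchange)

lemma involutive_m_BE_Phi: "involutive_m_BE_algebra (Phi imp star) star \<one>"
proof
  fix x y z
  \<comment> \<open>Associativity of \<open>Phi imp star\<close> once double stars cancel and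
    \<open>z\<close> is moved to the front.\<close>
  have "z \<rightarrow> (x \<rightarrow> y\<^sup>\<star>) = x \<rightarrow> (y \<rightarrow> z\<^sup>\<star>)"
    by (metis imp_exchange imp_star_commute)
  then show "Phi imp star x (Phi imp star y z) = Phi imp star (Phi imp star x y) z"
    by (simp add: Phi_def star_star imp_star_commute[of _ z])
  show "Phi imp star x y = Phi imp star y x"
    by (simp add: Phi_def imp_star_commute[of x y])
qed (simp_all add: Phi_def star_star one_imp imp_one_star imp_one imp_refl)

lemma Psi_Phi: "Psi (Phi imp star) star = imp"
  by (simp add: Psi_def Phi_def star_star)

end

context involutive_m_BE_algebra
begin

lemma Phi_Psi: "Phi (Psi dot star) star = dot"
  by (simp add: Psi_def Phi_def star_star)

lemma involutive_BE_Psi: "involutive_BE_algebra (Psi dot star) star \<one>"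
proof -
  interpret BE: BE_algebra "Psi dot star" \<one>
  proof
    fix x y z
    show "Psi dot star x (Psi dot star y z) = Psi dot star y (Psi dot star x z)"
      by (simp add: Psi_apply star_star dot_assoc dot_commute[of x y])
  qed (simp_all add: Psi_apply dot_star dot_zero one_dot star_star)
  show ?thesis
  proof
    show "\<exists>zero. (\<forall>x. BE.le zero x) \<and> (\<forall>x. x\<^sup>\<star> = Psi dot star x zero)"
      by (rule exI[of _ "\<one>\<^sup>\<star>"])
        (simp add: BE.le_def Psi_apply star_star dot_one dot_commute[of "\<one>\<^sup>\<star>"] dot_zero)
  qed (rule star_star)
qed

lemma cap_Psi: "involutive_BE_algebra.cap (Psi dot star) star x y = x \<sqinter> y"
  by (simp add: involutive_BE_algebra.cap_def[OF involutive_BE_Psi] cap_def oplus_def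
      Psi_apply star_star)

lemma star_cap: "(x \<sqinter> y)\<^sup>\<star> = x\<^sup>\<star> \<squnion> y\<^sup>\<star>"
  by (simp add: cap_def cup_def oplus_def star_star)

lemma star_cup: "(x \<squnion> y)\<^sup>\<star> = x\<^sup>\<star> \<sqinter> y\<^sup>\<star>"
  by (simp add: cap_def cup_def oplus_def star_star)

lemma star_eq_iff: "x\<^sup>\<star> = y\<^sup>\<star> \<longleftrightarrow> x = y"
  by (metis star_star)

lemma oplus_commute: "x \<oplus> y = y \<oplus> x"
  by (simp add: oplus_def dot_commute)

lemma oplus_assoc: "x \<oplus> (y \<oplus> z) = (x \<oplus> y) \<oplus> z"
  by (simp add: oplus_def star_star dot_assoc)

lemma pre_Wajsberg_Psi_iff:
  "pre_Wajsberg_algebra (Psi dot star) star \<one> \<longleftrightarrow> pre_MV_algebra dot star \<one>"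
proof -
  have "pre_Wajsberg_algebra (Psi dot star) star \<one> \<longleftrightarrow>
      (\<forall>x y. x \<odot> (x\<^sup>\<star> \<squnion> y\<^sup>\<star>) = x \<odot> y\<^sup>\<star>)"
    by (simp add: pre_Wajsberg_algebra_def pre_Wajsberg_algebra_axioms_def involutive_BE_Psi
        cap_Psi Psi_apply star_eq_iff star_cap)
  \<comment> \<open>The star is surjective, being an involution, so \<open>y\<^sup>\<star>\<close>
    ranges over all elements.\<close>
  also have "\<dots> \<longleftrightarrow> (\<forall>x y. x \<odot> (x\<^sup>\<star> \<squnion> y) = x \<odot> y)"
    by (metis star_star)
  also have "\<dots> \<longleftrightarrow> pre_MV_algebra dot star \<one>"
    by (simp add: pre_MV_algebra_def pre_MV_algebra_axioms_def involutive_m_BE_algebra_axioms)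
  finally show ?thesis .
qed

lemma meta_Wajsberg_Psi_iff:
  "meta_Wajsberg_algebra (Psi dot star) star \<one> \<longleftrightarrow> meta_MV_algebra dot star \<one>"
proof -
  have "u\<^sup>\<star> = \<one> \<longleftrightarrow> u = \<one>\<^sup>\<star>" for u
    by (metis star_star)
  then show ?thesis
    by (simp add: meta_Wajsberg_algebra_def meta_Wajsberg_algebra_axioms_def involutive_BE_Psi
        cap_Psi Psi_apply meta_MV_algebra_def meta_MV_algebra_axioms_def
        involutive_m_BE_algebra_axioms)
qed

lemma orthomodular_if_implicative_orthomodular_Psi:
  assumes "implicative_orthomodular_algebra (Psi dot star) star \<one>"
  shows "orthomodular_algebra dot star \<one>"
proof
  fix x y
  have zero_cap: "\<one>\<^sup>\<star> \<sqinter> u = \<one>\<^sup>\<star>" for u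
    by (simp add: cap_def oplus_def star_star one_dot dot_star dot_commute[of "u\<^sup>\<star>"])
  \<comment> \<open>The axiom at \<open>\<one>\<^sup>\<star>\<close> and
    \<open>y\<^sup>\<star>\<close>: by \<open>zero_cap\<close> the left side collapses to
    \<open>x\<^sup>\<star>\<close>.\<close>
  have "Psi dot star x (\<one>\<^sup>\<star> \<sqinter> (y\<^sup>\<star> \<sqinter> x)) = Psi dot star x \<one>\<^sup>\<star> \<sqinter> Psi dot star x y\<^sup>\<star>"
    using implicative_orthomodular_algebra.implicative_orthomodular[OF assms]
    by (simp add: cap_Psi)
  then have "x\<^sup>\<star> = x\<^sup>\<star> \<sqinter> (x \<odot> y)\<^sup>\<star>"
    by (simp add: zero_cap Psi_apply star_star dot_one)
  then show "x \<squnion> (x \<odot> y) = x"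
    by (metis star_cup star_eq_iff)
qed

end

context orthomodular_algebra
begin

text \<open>The De Morgan dual of the orthomodular law. It turns any decomposition
  \<open>b = a \<oplus> s\<close> into \<open>a \<sqinter> b = a\<close>.\<close>

lemma cap_oplus: "x \<sqinter> (x \<oplus> y) = x"
  using orthomodular[of "x\<^sup>\<star>" "y\<^sup>\<star>"]
  by (metis oplus_def star_cup star_star)

lemma cup_dot_cap:
  "((x \<odot> y) \<squnion> (x \<odot> z)) \<sqinter> x = (x \<odot> y) \<squnion> (x \<odot> z)"
proof -
  define c d e where "c = x \<odot> z" and "d = x \<odot> c\<^sup>\<star>" and "e = d \<odot> y"
  have "x = d \<oplus> c"
    using orthomodular[of x z] by (simp add: cup_def c_def d_def)
  also have "d = (d \<odot> e\<^sup>\<star>) \<oplus> e"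
    using orthomodular[of d y] by (simp add: cup_def e_def)
  finally have "x = (e \<oplus> c) \<oplus> (d \<odot> e\<^sup>\<star>)"
    by (metis oplus_assoc oplus_commute)
  \<comment> \<open>Reordering the factors gives
    \<open>e = (x \<odot> y) \<odot> c\<^sup>\<star>\<close>, exactly the first summand in the
    definition of \<open>\<squnion>\<close>.\<close>
  moreover have "e \<oplus> c = (x \<odot> y) \<squnion> c"
    unfolding cup_def d_def e_def by (metis dot_assoc dot_commute)
  ultimately show ?thesis
    using cap_oplus by (metis c_def)
qed

text \<open>The involutive m-BE laws alone rewrite the left side as the right side capped with
  \<open>x\<close>; orthomodularity enters only through \<open>cup_dot_cap\<close>, which removes
  that cap.\<close>

lemma dot_cup_cup:
  "x \<odot> (y \<squnion> (z \<squnion> x\<^sup>\<star>)) = (x \<odot> y) \<squnion> (x \<odot> z)"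
proof -
  define c where "c = x \<odot> z"
  have z: "z \<squnion> x\<^sup>\<star> = c \<oplus> x\<^sup>\<star>"
    by (simp add: cup_def c_def star_star dot_commute)
  have "(c \<oplus> x\<^sup>\<star>)\<^sup>\<star> = x \<odot> c\<^sup>\<star>"
    by (simp add: oplus_def star_star dot_commute)
  then have "y \<squnion> (c \<oplus> x\<^sup>\<star>) = ((x \<odot> y) \<squnion> c) \<oplus> x\<^sup>\<star>"
    by (simp add: cup_def dot_assoc oplus_assoc dot_commute[of x y])
  then have "x \<odot> (y \<squnion> (z \<squnion> x\<^sup>\<star>)) = ((x \<odot> y) \<squnion> c) \<sqinter> x"
    unfolding z by (simp add: cap_def dot_commute)
  then show ?thesis
    using cup_dot_cap by (simp add: c_def)
qed

lemma implicative_orthomodular_Psi: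
  "implicative_orthomodular_algebra (Psi dot star) star \<one>"
proof -
  \<comment> \<open>Pushing stars inward reduces this to \<open>dot_cup_cup\<close> at
    \<open>y\<^sup>\<star>\<close> and \<open>z\<^sup>\<star>\<close>.\<close>
  have "(x \<odot> (y \<sqinter> (z \<sqinter> x))\<^sup>\<star>)\<^sup>\<star> = (x \<odot> y\<^sup>\<star>)\<^sup>\<star> \<sqinter> (x \<odot> z\<^sup>\<star>)\<^sup>\<star>" for x y z
    by (simp add: star_cap dot_cup_cup star_cup)
  then show ?thesis
    by (simp add: implicative_orthomodular_algebra_def
        implicative_orthomodular_algebra_axioms_def involutive_BE_Psi cap_Psi Psi_apply)
qed

end

lemma (in involutive_m_BE_algebra) implicative_orthomodular_Psi_iff:
  "implicative_orthomodular_algebra (Psi dot star) star \<one> \<longleftrightarrow> orthomodular_algebra dot star \<one>"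
  by (rule iffI[OF orthomodular_if_implicative_orthomodular_Psi
    orthomodular_algebra.implicative_orthomodular_Psi])

text \<open>A criterion for \<open>Psi\<close> alone suffices: since \<open>Psi\<close> undoes
  \<open>Phi\<close>, applying \<open>iff\<close> to \<open>Phi imp star\<close> settles the passage
  from \<open>C\<close> to \<open>D\<close> as well.\<close>

lemma term_equivalentI:
  assumes C: "\<And>imp star one. C imp star one \<Longrightarrow> involutive_BE_algebra imp star one"
    and D: "\<And>dot star one. D dot star one \<Longrightarrow> involutive_m_BE_algebra dot star one"
    and iff: "\<And>dot star one. involutive_m_BE_algebra dot star one \<Longrightarrow>
      C (Psi dot star) star one \<longleftrightarrow> D dot star one"
  shows "term_equivalent C D"
  unfolding term_equivalent_def
proof (intro conjI allI impI)
  fix imp star one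
  assume c: "C imp star one"
  then interpret involutive_BE_algebra imp star one by (rule C)
  show "Psi (Phi imp star) star = imp" by (rule Psi_Phi)
  with c show "D (Phi imp star) star one"
    using iff[OF involutive_m_BE_Phi] by simp
next
  fix dot star one
  assume d: "D dot star one"
  then interpret involutive_m_BE_algebra dot star one by (rule D)
  show "Phi (Psi dot star) star = dot" by (rule Phi_Psi)
  show "C (Psi dot star) star one"
    using d iff[OF involutive_m_BE_algebra_axioms] by simp
qed

theorem proposition3p11:
  shows "term_equivalent (pre_Wajsberg_algebra :: 'a algebra_class) pre_MV_algebra
    \<and> term_equivalent (implicative_orthomodular_algebra :: 'a algebra_class) orthomodular_algebra
    \<and> term_equivalent (meta_Wajsberg_algebra :: 'a algebra_class) meta_MV_algebra"
  by (intro conjI term_equivalentI)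
    (simp_all add: pre_Wajsberg_algebra.axioms(1) pre_MV_algebra.axioms(1)
      implicative_orthomodular_algebra.axioms(1) orthomodular_algebra.axioms(1)
      meta_Wajsberg_algebra.axioms(1) meta_MV_algebra.axioms(1)
      involutive_m_BE_algebra.pre_Wajsberg_Psi_iff
      involutive_m_BE_algebra.implicative_orthomodular_Psi_iff
      involutive_m_BE_algebra.meta_Wajsberg_Psi_iff)

end
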